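(* Let $\bar x=(\bar x_1,\bar x_2,\dots)\in l_1$ with $\|\bar x\|\ge 1$ and $\bar y=(\bar y_1,\bar y_2,\dots)\in P_{\mathbb B}(\bar x)$. Then, for $y^*=(y_1^*,y_2^*,\dots)\in l_\infty$, the Mordukhovich derivative $\widehat D^*P_{\mathbb B}(\bar x,\bar y)(y^* )\subseteq l_\infty$ has the following properties. (A) If $\bar x\in K$, then every $x^*\in\widehat D^*P_{\mathbb B}(\bar x,\bar y)(y^* )$ satisfies $x_n^*\le 0$ for all $n\ge1$. (B) If $\bar x\in -K$, then every $x^*\in\widehat D^*P_{\mathbb B}(\bar x,\bar y)(y^* )$ satisfies $x_n^*\ge 0$ for all $n\ge1$. (C) If $y_1^*=y_2^*=\cdots$, then: (I) if $\sum_{n=1}^\infty\bar y_n=1$ and $y_1^*\le 0$, then $\theta\in\widehat D^*P_{\mathbb B}(\bar x,\bar y)(y^* )$; (II) if $\sum_{n=1}^\infty\bar y_n=-1$ and $y_1^*\ge 0$, then $\theta\in\widehat D^*P_{\mathbb B}(\bar x,\bar y)(y^* )$; (III) if $\bar x\in K$ and $y_1^*\le 0$, then $\theta\in\widehat D^*P_{\mathbb B}(\bar x,\bar y)(y^* )$; (IV) if $\bar x\in -K$ and $y_1^*\ge 0$, then $\theta\in\widehat D^*P_{\mathbb B}(\bar x,\bar y)(y^* )$; (V) if $\bar x\in K$, then $\theta\in\widehat D^*P_{\mathbb B}(\bar x,\bar y)(-\beta)$; (VI) if $\bar x\in -K$, then $\theta\in\widehat D^*P_{\mathbb B}(\bar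 x,\bar y)(\beta)$. (D) If $y_1^*=y_2^*=\cdots$ with $y_1^*\ne 0$, and $-1<\sum_{n=1}^\infty\bar y_n<1$, then $\theta\notin\widehat D^*P_{\mathbb B}(\bar x,\bar y)(y^* )$. Moreover, without the assumption $\|\bar x\|\ge 1$: (E) For any $\bar x\in\mathbb B^o$, we have $P_{\mathbb B}(\bar x)=\{\bar x\}$ and $\widehat D^*P_{\mathbb B}(\bar x,\bar x)(y^* )=\{y^*\}$ for any $y^*\in l_\infty$.
   Context: $(l_1,\|\cdot\|)$ is the real Banach space of absolutely summable real sequences with $\|x\|=\sum_{n=1}^\infty|x_n|$; its dual is $l_\infty$ with the supremum norm and pairing $\langle y^*,x\rangle=\sum_{n=1}^\infty x_ny_n^*$. $\theta=(0,0,\dots)$ and $\beta=(1,1,\dots)\in l_\infty$. $\mathbb B=\{x\in l_1:\|x\|\le1\}$ and $\mathbb B^o$ is its topological interior. $K=\{x\in l_1:x_n\ge0\ \forall n\ge1\}$, $-K=\{-x:x\in K\}$. The set-valued metric projection is $P_{\mathbb B}(x)=\{u\in\mathbb B:\|x-u\|\le\|x-v\|\ \forall v\in\mathbb B\}$ for $x\in l_1$. For a set-valued mapping $F:X\rightrightarrows Y$ between Banach spaces with graph $\mathrm{gph}F=\{(x,y):y\in F(x)\}$, and $(x,y)\in\mathrm{gph}F$, the Mordukhovich derivative (coderivative) $\widehat D^*F(x,y):Y^*\rightrightarrows X^*$ is $$\widehat D^*F(x,y)(y^* )=\Big\{x^*\in X^*:\ \limsup_{(u,v)\to(x,y),\ (u,v)\in\mathrm{gph}F}\frac{\langle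 x^*,u-x\rangle-\langle y^*,v-y\rangle}{\|u-x\|_X+\|v-y\|_Y}\le0\Big\},$$ where the limsup is over $(u,v)\ne(x,y)$. Here $X=Y=l_1$ and $F=P_{\mathbb B}$. *)

theory Defs
  imports "HOL-Analysis.Analysis"
begin

section \<open>The Banach space \<open>l\<^sub>1\<close>\<close>

text \<open>Sequences are indexed by \<^typ>\<open>nat\<close>, so the coordinate \<open>x\<^sub>n\<close> for \<open>n \<ge> 1\<close> is
  \<open>l1_nth x (n - 1)\<close>.\<close>

typedef l1 = "{x :: nat \<Rightarrow> real. summable (\<lambda>n. \<bar>x n\<bar>)}"
  morphisms l1_nth Abs_l1
  by (rule exI[of _ "\<lambda>_. 0"]) simp

setup_lifting type_definition_l1

lemma l1_eqI: "(\<And>n. l1_nth x n = l1_nth y n) \<Longrightarrow> x = y"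
  by (metis l1_nth_inject ext)

lemma summable_abs_l1 [simp]: "summable (\<lambda>n. \<bar>l1_nth x n\<bar>)"
  using l1_nth[of x] by simp

lemma summable_l1 [simp]: "summable (l1_nth x)"
  by (rule summable_rabs_cancel) simp

instantiation l1 :: real_normed_vector
begin

lift_definition zero_l1 :: l1 is "\<lambda>_. 0" by simp

lift_definition plus_l1 :: "l1 \<Rightarrow> l1 \<Rightarrow> l1" is "\<lambda>x y n. x n + y n"
proof -
  fix x y :: "nat \<Rightarrow> real"
  assume "summable (\<lambda>n. \<bar>x n\<bar>)" "summable (\<lambda>n. \<bar>y n\<bar>)"
  then have "summable (\<lambda>n. \<bar>x n\<bar> + \<bar>y n\<bar>)"
    by (rule summable_add)
  then show "summable (\<lambda>n. \<bar>x n + y n\<bar>)"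
    by (rule summable_comparison_test[rotated]) (auto intro!: exI[of _ 0])
qed

lift_definition uminus_l1 :: "l1 \<Rightarrow> l1" is "\<lambda>x n. - x n" by simp

lift_definition minus_l1 :: "l1 \<Rightarrow> l1 \<Rightarrow> l1" is "\<lambda>x y n. x n - y n"
proof -
  fix x y :: "nat \<Rightarrow> real"
  assume "summable (\<lambda>n. \<bar>x n\<bar>)" "summable (\<lambda>n. \<bar>y n\<bar>)"
  then have "summable (\<lambda>n. \<bar>x n\<bar> + \<bar>y n\<bar>)"
    by (rule summable_add)
  then show "summable (\<lambda>n. \<bar>x n - y n\<bar>)"
    by (rule summable_comparison_test[rotated]) (auto intro!: exI[of _ 0])
qed

lift_definition scaleR_l1 :: "real \<Rightarrow> l1 \<Rightarrow> l1" is "\<lambda>c x n. c * x n"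
  by (simp add: abs_mult summable_mult)

definition norm_l1 :: "l1 \<Rightarrow> real"
  where "norm_l1 x = (\<Sum>n. \<bar>l1_nth x n\<bar>)"

definition dist_l1 :: "l1 \<Rightarrow> l1 \<Rightarrow> real"
  where "dist_l1 x y = norm (x - y)"

definition sgn_l1 :: "l1 \<Rightarrow> l1"
  where "sgn_l1 x = scaleR (inverse (norm x)) x"

definition uniformity_l1 :: "(l1 \<times> l1) filter"
  where "uniformity_l1 = (INF e\<in>{0<..}. principal {(x, y). dist x y < e})"

definition open_l1 :: "l1 set \<Rightarrow> bool"
  where "open_l1 U = (\<forall>x\<in>U. \<forall>\<^sub>F (x', y) in uniformity. x' = x \<longrightarrow> y \<in> U)"

instance
proof
  fix x y z :: l1 and a b :: real
  show "x + y + z = x + (y + z)" by transfer (simp add: fun_eq_iff)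
  show "x + y = y + x" by transfer (simp add: fun_eq_iff)
  show "0 + x = x" by transfer simp
  show "- x + x = 0" by transfer simp
  show "x - y = x + - y" by transfer simp
  show "a *\<^sub>R (x + y) = a *\<^sub>R x + a *\<^sub>R y" by transfer (simp add: algebra_simps)
  show "(a + b) *\<^sub>R x = a *\<^sub>R x + b *\<^sub>R x" by transfer (simp add: algebra_simps)
  show "a *\<^sub>R b *\<^sub>R x = (a * b) *\<^sub>R x" by transfer (simp add: algebra_simps)
  show "1 *\<^sub>R x = x" by transfer simp
  show "norm x = 0 \<longleftrightarrow> x = 0"
    unfolding norm_l1_def
    by (subst suminf_eq_zero_iff) (auto simp: zero_l1.rep_eq intro: l1_eqI)
  show "norm (x + y) \<le> norm x + norm y"
  proof -
    have "(\<Sum>n. \<bar>l1_nth (x + y) n\<bar>) \<le> (\<Sum>n. \<bar>l1_nth x n\<bar> + \<bar>l1_nth y n\<bar>)"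
      by (intro suminf_le summable_add summable_abs_l1) (simp add: plus_l1.rep_eq abs_triangle_ineq)
    then show ?thesis
      by (simp add: norm_l1_def suminf_add)
  qed
  show "norm (a *\<^sub>R x) = \<bar>a\<bar> * norm x"
    by (simp add: norm_l1_def scaleR_l1.rep_eq abs_mult suminf_mult)
qed (simp_all add: dist_l1_def sgn_l1_def uniformity_l1_def open_l1_def)

end

lemmas l1_nth_simps [simp] =
  zero_l1.rep_eq plus_l1.rep_eq uminus_l1.rep_eq minus_l1.rep_eq scaleR_l1.rep_eq

lemma sum_abs_le_norm_l1: "(\<Sum>n<N. \<bar>l1_nth x n\<bar>) \<le> norm x"
  unfolding norm_l1_def by (intro sum_le_suminf) auto

lemma abs_l1_nth_le_norm: "\<bar>l1_nth x n\<bar> \<le> norm x"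
proof -
  have "\<bar>l1_nth x n\<bar> \<le> (\<Sum>k<Suc n. \<bar>l1_nth x k\<bar>)"
    by (rule member_le_sum) auto
  then show ?thesis
    using sum_abs_le_norm_l1[of x "Suc n"] by linarith
qed

instance l1 :: banach
proof
  fix X :: "nat \<Rightarrow> l1"
  assume X: "Cauchy X"
  have "Cauchy (\<lambda>m. l1_nth (X m) n)" for n
  proof (rule metric_CauchyI)
    fix e :: real assume "e > 0"
    then obtain M where "\<And>m k. m \<ge> M \<Longrightarrow> k \<ge> M \<Longrightarrow> dist (X m) (X k) < e"
      using metric_CauchyD[OF X] by blast
    moreover have "dist (l1_nth (X m) n) (l1_nth (X k) n) \<le> dist (X m) (X k)" for m k
      using abs_l1_nth_le_norm[of "X m - X k" n] by (simp add: dist_norm)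
    ultimately show "\<exists>M. \<forall>m\<ge>M. \<forall>k\<ge>M. dist (l1_nth (X m) n) (l1_nth (X k) n) < e"
      by (meson le_less_trans)
  qed
  then have "\<forall>n. \<exists>l. (\<lambda>m. l1_nth (X m) n) \<longlonglongrightarrow> l"
    using Cauchy_convergent_iff convergent_def by blast
  then obtain L where L: "\<And>n. (\<lambda>m. l1_nth (X m) n) \<longlonglongrightarrow> L n"
    by metis
  have *: "\<exists>M. \<forall>m\<ge>M. \<forall>N. (\<Sum>n<N. \<bar>l1_nth (X m) n - L n\<bar>) \<le> e" if "e > 0" for e :: real
  proof -
    obtain M where M: "\<And>m k. m \<ge> M \<Longrightarrow> k \<ge> M \<Longrightarrow> dist (X m) (X k) < e"
      using metric_CauchyD[OF X \<open>e > 0\<close>] by blast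
    have "(\<Sum>n<N. \<bar>l1_nth (X m) n - L n\<bar>) \<le> e" if "m \<ge> M" for m N
    proof (rule tendsto_upperbound)
      show "(\<lambda>k. \<Sum>n<N. \<bar>l1_nth (X m) n - l1_nth (X k) n\<bar>) \<longlonglongrightarrow> (\<Sum>n<N. \<bar>l1_nth (X m) n - L n\<bar>)"
        by (intro tendsto_intros L)
      show "\<forall>\<^sub>F k in sequentially. (\<Sum>n<N. \<bar>l1_nth (X m) n - l1_nth (X k) n\<bar>) \<le> e"
        using eventually_ge_at_top[of M]
      proof eventually_elim
        case (elim k)
        show ?case
          using sum_abs_le_norm_l1[of "X m - X k" N] M[OF \<open>m \<ge> M\<close> elim] by (simp add: dist_norm)
      qed
    qed simp
    then show ?thesis by blast
  qed
  obtain M where M: "\<And>m N. m \<ge> M \<Longrightarrow> (\<Sum>n<N. \<bar>l1_nth (X m) n - L n\<bar>) \<le> 1"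
    using *[of 1] by auto
  have "summable (\<lambda>n. \<bar>L n - l1_nth (X M) n\<bar>)"
  proof (rule bounded_imp_summable)
    show "(\<Sum>k\<le>n. \<bar>L k - l1_nth (X M) k\<bar>) \<le> 1" for n
      using M[of M "Suc n"] unfolding lessThan_Suc_atMost by (simp add: abs_minus_commute)
  qed simp
  then have "summable (\<lambda>n. \<bar>L n - l1_nth (X M) n\<bar> + \<bar>l1_nth (X M) n\<bar>)"
    by (intro summable_add) auto
  then have "summable (\<lambda>n. \<bar>L n\<bar>)"
    by (rule summable_comparison_test[rotated]) (auto intro!: exI[of _ 0])
  then have L': "l1_nth (Abs_l1 L) = L"
    by (simp add: Abs_l1_inverse)
  have "X \<longlonglongrightarrow> Abs_l1 L"
  proof (rule metric_LIMSEQ_I)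
    fix e :: real assume "e > 0"
    then obtain M where M: "\<And>m N. m \<ge> M \<Longrightarrow> (\<Sum>n<N. \<bar>l1_nth (X m) n - L n\<bar>) \<le> e / 2"
      using *[of "e / 2"] by auto
    have "dist (X m) (Abs_l1 L) < e" if "m \<ge> M" for m
    proof -
      have "norm (X m - Abs_l1 L) \<le> e / 2"
        unfolding norm_l1_def
      proof (rule suminf_le_const)
        show "(\<Sum>n<N. \<bar>l1_nth (X m - Abs_l1 L) n\<bar>) \<le> e / 2" for N
          using M[OF that, of N] by (simp add: L')
      qed (rule summable_abs_l1)
      then show ?thesis using \<open>e > 0\<close> by (simp add: dist_norm)
    qed
    then show "\<exists>no. \<forall>m\<ge>no. dist (X m) (Abs_l1 L) < e" by blast
  qed
  then show "convergent X" by (auto simp: convergent_def)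
qed


section \<open>The dual space \<open>l\<^sub>\<infinity>\<close>\<close>

text \<open>On the discrete space \<^typ>\<open>nat\<close> every function is continuous, so
  \<^typ>\<open>nat \<Rightarrow>\<^sub>C real\<close> consists of all bounded real sequences, with the supremum norm.\<close>

type_synonym linf = "nat \<Rightarrow>\<^sub>C real"

lemma summable_abs_l1_mult_linf: "summable (\<lambda>n. \<bar>l1_nth x n * (y :: linf) n\<bar>)"
proof (rule summable_comparison_test[OF _ summable_mult2[OF summable_abs_l1]])
  show "\<exists>N. \<forall>n\<ge>N. norm \<bar>l1_nth x n * y n\<bar> \<le> \<bar>l1_nth x n\<bar> * norm y"
    using norm_bounded[of y] by (auto simp: abs_mult intro!: mult_left_mono)
qed

lift_definition linf_dual :: "linf \<Rightarrow> (l1 \<Rightarrow>\<^sub>L real)"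
  is "\<lambda>(y :: linf) (x :: l1). \<Sum>n. l1_nth x n * y n"
proof (rule bounded_linear_intro)
  fix y :: linf and x z :: l1 and r :: real
  note s = summable_rabs_cancel[OF summable_abs_l1_mult_linf]
  show "(\<Sum>n. l1_nth (x + z) n * y n) = (\<Sum>n. l1_nth x n * y n) + (\<Sum>n. l1_nth z n * y n)"
    by (simp add: distrib_right suminf_add s)
  show "(\<Sum>n. l1_nth (r *\<^sub>R x) n * y n) = r *\<^sub>R (\<Sum>n. l1_nth x n * y n)"
    by (simp add: mult.assoc suminf_mult s)
  have "norm (\<Sum>n. l1_nth x n * y n) \<le> (\<Sum>n. \<bar>l1_nth x n * y n\<bar>)"
    unfolding real_norm_def by (rule summable_rabs[OF summable_abs_l1_mult_linf])
  also have "\<dots> \<le> (\<Sum>n. \<bar>l1_nth x n\<bar> * norm y)"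
    using norm_bounded[of y]
    by (intro suminf_le summable_abs_l1_mult_linf summable_mult2 summable_abs_l1)
       (auto simp: abs_mult intro!: mult_left_mono)
  also have "\<dots> = norm x * norm y"
    by (simp add: norm_l1_def suminf_mult2[symmetric])
  finally show "norm (\<Sum>n. l1_nth x n * y n) \<le> norm x * norm y" .
qed

lift_definition l1_unit :: "nat \<Rightarrow> l1" is "\<lambda>k n. if n = k then 1 else 0"
  by (rule summable_finite[of "{k}" for k]) auto

lemma norm_l1_unit: "norm (l1_unit k) = 1"
proof -
  have "(\<Sum>n. \<bar>l1_nth (l1_unit k) n\<bar>) = (\<Sum>n\<in>{k}. \<bar>l1_nth (l1_unit k) n\<bar>)"
    by (rule suminf_finite) (auto simp: l1_unit.rep_eq)
  then show ?thesis by (simp add: norm_l1_def l1_unit.rep_eq)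
qed

lemma linf_dual_unit: "linf_dual y (l1_unit k) = y k"
proof -
  have "(\<Sum>n. l1_nth (l1_unit k) n * y n) = (\<Sum>n\<in>{k}. l1_nth (l1_unit k) n * y n)"
    by (rule suminf_finite) (auto simp: l1_unit.rep_eq)
  then show ?thesis by (simp add: linf_dual.rep_eq l1_unit.rep_eq)
qed

lemma l1_unit_expansion: "(\<lambda>k. l1_nth x k *\<^sub>R l1_unit k) sums x"
proof -
  have nth: "l1_nth (\<Sum>k<N. l1_nth x k *\<^sub>R l1_unit k) n = (if n < N then l1_nth x n else 0)" for N n
    by (induction N) (auto simp: l1_unit.rep_eq less_Suc_eq)
  have "norm (x - (\<Sum>k<N. l1_nth x k *\<^sub>R l1_unit k)) = norm x - (\<Sum>n<N. \<bar>l1_nth x n\<bar>)" for N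
  proof -
    have "(\<Sum>n. \<bar>l1_nth x n\<bar> - (if n \<in> {..<N} then \<bar>l1_nth x n\<bar> else 0))
        = norm x - (\<Sum>n<N. \<bar>l1_nth x n\<bar>)"
      unfolding norm_l1_def
      using sums_If_finite_set[of "{..<N}" "\<lambda>n. \<bar>l1_nth x n\<bar>"]
      by (intro sums_unique[symmetric] sums_diff summable_sums summable_abs_l1) auto
    moreover have "\<bar>l1_nth x n - l1_nth (\<Sum>k<N. l1_nth x k *\<^sub>R l1_unit k) n\<bar>
        = \<bar>l1_nth x n\<bar> - (if n \<in> {..<N} then \<bar>l1_nth x n\<bar> else 0)" for n
      by (simp add: nth)
    ultimately show ?thesis by (simp add: norm_l1_def)
  qed
  moreover have "(\<lambda>N. norm x - (\<Sum>n<N. \<bar>l1_nth x n\<bar>)) \<longlonglongrightarrow> norm x - norm x"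
    by (intro tendsto_intros) (simp add: norm_l1_def summable_LIMSEQ)
  ultimately have "(\<lambda>N. norm (x - (\<Sum>k<N. l1_nth x k *\<^sub>R l1_unit k))) \<longlonglongrightarrow> 0"
    by simp
  then show ?thesis
    unfolding sums_def by (subst tendsto_dist_iff) (simp only: dist_norm norm_minus_commute[of _ x])
qed

text \<open>\<^const>\<open>linf_dual\<close> identifies \<open>l\<^sub>\<infinity>\<close> isometrically with the whole dual of \<open>l\<^sub>1\<close>.\<close>

lemma bij_linf_dual: "bij linf_dual"
proof (rule bijI)
  show "inj linf_dual"
    by (rule injI) (metis bcontfun_eqI linf_dual_unit)
  have "f \<in> range linf_dual" for f :: "l1 \<Rightarrow>\<^sub>L real"
  proof -
    have "(\<lambda>n. f (l1_unit n)) \<in> bcontfun"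
    proof (rule bcontfun_normI)
      show "norm (f (l1_unit n)) \<le> norm f" for n
        using norm_blinfun[of f "l1_unit n"] by (simp add: norm_l1_unit)
    qed simp
    then obtain y :: linf where y: "apply_bcontfun y = (\<lambda>n. f (l1_unit n))"
      by (metis bcontfunE)
    have "f x = linf_dual y x" for x
    proof -
      have "(\<lambda>k. f (l1_nth x k *\<^sub>R l1_unit k)) sums f x"
        by (intro bounded_linear.sums[OF blinfun.bounded_linear_right] l1_unit_expansion)
      then show ?thesis
        by (simp add: linf_dual.rep_eq y blinfun.scaleR_right sums_iff)
    qed
    then have "f = linf_dual y" by (rule blinfun_eqI)
    then show ?thesis by blast
  qed
  then show "surj linf_dual" by blast
qed

lemma norm_linf_dual: "norm (linf_dual y) = norm y"
proof (rule antisym)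
  show "norm (linf_dual y) \<le> norm y"
  proof (rule norm_blinfun_bound)
    fix x
    have "norm (linf_dual y x) \<le> (\<Sum>n. \<bar>l1_nth x n * y n\<bar>)"
      unfolding real_norm_def linf_dual.rep_eq by (rule summable_rabs[OF summable_abs_l1_mult_linf])
    also have "\<dots> \<le> (\<Sum>n. \<bar>l1_nth x n\<bar> * norm y)"
      using norm_bounded[of y]
      by (intro suminf_le summable_abs_l1_mult_linf summable_mult2 summable_abs_l1)
         (auto simp: abs_mult intro!: mult_left_mono)
    also have "\<dots> = norm y * norm x"
      by (simp add: norm_l1_def suminf_mult2[symmetric])
    finally show "norm (linf_dual y x) \<le> norm y * norm x" .
  qed simp
  show "norm y \<le> norm (linf_dual y)"
    by (rule norm_bound) (metis linf_dual_unit mult.right_neutral norm_blinfun norm_l1_unit)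
qed


section \<open>Metric projection and Mordukhovich derivative\<close>

definition metric_projection :: "'a::real_normed_vector set \<Rightarrow> 'a \<Rightarrow> 'a set"
  where "metric_projection C x = {u \<in> C. \<forall>v\<in>C. norm (x - u) \<le> norm (x - v)}"

definition gph :: "('a \<Rightarrow> 'b set) \<Rightarrow> ('a \<times> 'b) set"
  where "gph F = {(x, y). y \<in> F x}"

text \<open>The filter \<open>at (x, y) within gph F\<close> excludes the point \<open>(x, y)\<close> itself. As in the
  mathematical definition, the notion is meant for \<open>(x, y) \<in> gph F\<close>.\<close>

definition mordukhovich_derivative ::
    "('a::banach \<Rightarrow> 'b::banach set) \<Rightarrow> 'a \<Rightarrow> 'b \<Rightarrow> ('b \<Rightarrow>\<^sub>L real) \<Rightarrow> ('a \<Rightarrow>\<^sub>L real) set"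
  where "mordukhovich_derivative F x y ystar =
    {xstar :: 'a \<Rightarrow>\<^sub>L real. Limsup (at (x, y) within gph F)
       (\<lambda>(u, v). ereal ((xstar (u - x) - ystar (v - y)) / (norm (u - x) + norm (v - y)))) \<le> 0}"

text \<open>For \<open>l\<^sub>1\<close>, with dual elements represented by bounded sequences.\<close>

definition mordukhovich_derivative_l1 :: "(l1 \<Rightarrow> l1 set) \<Rightarrow> l1 \<Rightarrow> l1 \<Rightarrow> linf \<Rightarrow> linf set"
  where "mordukhovich_derivative_l1 F x y ystar =
    {xstar. linf_dual xstar \<in> mordukhovich_derivative F x y (linf_dual ystar)}"

abbreviation unit_ball_l1 :: "l1 set"
  where "unit_ball_l1 \<equiv> cball 0 1"

abbreviation proj_ball :: "l1 \<Rightarrow> l1 set"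
  where "proj_ball \<equiv> metric_projection unit_ball_l1"

definition nonneg_cone_l1 :: "l1 set"
  where "nonneg_cone_l1 = {x. \<forall>n. l1_nth x n \<ge> 0}"

definition beta_linf :: linf
  where "beta_linf = const_bcontfun 1"

end

theory Submission
  imports Defs
begin

text \<open>For \<open>\<parallel>x\<parallel> \<ge> 1\<close> the distance from \<open>x\<close> to the ball is \<open>\<parallel>x\<parallel> - 1\<close>, so \<open>y \<in> P(x)\<close> holds iff
  \<open>\<parallel>y\<parallel> \<le> 1\<close> and \<open>\<parallel>x - y\<parallel> = \<parallel>x\<parallel> - 1\<close>. In \<open>l\<^sub>1\<close> this forces \<open>\<parallel>y\<parallel> = 1\<close> and
  \<open>\<bar>x\<^sub>n - y\<^sub>n\<bar> = \<bar>x\<^sub>n\<bar> - \<bar>y\<^sub>n\<bar>\<close> for every \<open>n\<close>. Elements of the derivative are excluded by testing it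
  along segments \<open>(x + t a, y + t b)\<close> contained in the graph: (A) and (B) move a single
  coordinate of \<open>x\<close> away from \<open>0\<close> and keep \<open>y\<close> fixed; (D) moves a positive and a negative
  coordinate of \<open>x\<close> and \<open>y\<close> by the same amount, which preserves both norms but changes the
  coordinate sum. (C) holds because the coordinate sum of \<open>y\<close> is then extremal among all
  points of the ball. In (E) the projection is the identity near \<open>x\<close>.\<close>

section \<open>The metric projection onto the unit ball\<close>

text \<open>The reverse triangle inequality bounds every distance to the ball below by
  \<open>norm x - 1\<close>, and the radial point \<open>(1 / norm x) *\<^sub>R x\<close> attains
  this bound.\<close>

lemma mem_metric_projection_cball_iff:
  fixes x y :: "'a::real_normed_vector"
  assumes "norm x \<ge> 1"
  shows "y \<in> metric_projection (cball 0 1) x \<longleftrightarrow> norm y \<le> 1 \<and> norm (x - y) = norm x - 1"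
proof -
  have "x \<noteq> 0"
    using assms by auto
  have lower: "norm x - 1 \<le> norm (x - v)" if "norm v \<le> 1" for v
    using norm_triangle_ineq2[of x v] that by linarith
  have "x - (1 / norm x) *\<^sub>R x = (1 - 1 / norm x) *\<^sub>R x"
    by (simp add: scaleR_diff_left)
  moreover have "\<bar>1 - 1 / norm x\<bar> = 1 - 1 / norm x"
    using assms by (intro abs_of_nonneg) (simp add: divide_le_eq_1)
  moreover have "(1 - 1 / norm x) * norm x = norm x - 1"
    using \<open>x \<noteq> 0\<close> by (simp add: left_diff_distrib)
  ultimately have attained: "norm (x - (1 / norm x) *\<^sub>R x) = norm x - 1"
    by simp
  have unit: "(1 / norm x) *\<^sub>R x \<in> cball 0 1"
    by simp
  show ?thesis
  proof
    assume y: "y \<in> metric_projection (cball 0 1) x"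
    then have "norm (x - y) \<le> norm (x - (1 / norm x) *\<^sub>R x)"
      using unit unfolding metric_projection_def by blast
    with y lower[of y] attained show "norm y \<le> 1 \<and> norm (x - y) = norm x - 1"
      by (simp add: metric_projection_def)
  next
    assume "norm y \<le> 1 \<and> norm (x - y) = norm x - 1"
    then show "y \<in> metric_projection (cball 0 1) x"
      using lower by (simp add: metric_projection_def)
  qed
qed

lemma norm_metric_projection_cball:
  fixes x y :: "'a::real_normed_vector"
  assumes "norm x \<ge> 1" "y \<in> metric_projection (cball 0 1) x"
  shows "norm y = 1"
proof -
  have "norm y \<le> 1" "norm (x - y) = norm x - 1"
    using assms by (simp_all add: mem_metric_projection_cball_iff)
  then show ?thesis
    using norm_triangle_ineq2[of x y] by linarith
qed

text \<open>A small outward radial shift of \<open>x\<close> by length \<open>e\<close> stays in the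
  ball, so \<open>norm x + e \<le> 1\<close>.\<close>

lemma norm_less_one_if_interior_cball:
  fixes x :: "'a::real_normed_vector"
  assumes "x \<in> interior (cball 0 1)"
  shows "norm x < 1"
proof (cases "x = 0")
  case False
  obtain e where e: "e > 0" "cball x e \<subseteq> cball 0 1"
    using assms by (auto simp: mem_interior_cball)
  have "x + (e / norm x) *\<^sub>R x \<in> cball x e"
    using e(1) False by (simp add: dist_norm)
  with e(2) have "norm (x + (e / norm x) *\<^sub>R x) \<le> 1"
    by auto
  moreover have "x + (e / norm x) *\<^sub>R x = (1 + e / norm x) *\<^sub>R x"
    by (simp add: scaleR_add_left)
  moreover have "\<bar>1 + e / norm x\<bar> * norm x = norm x + e"
    using e(1) False by (simp add: field_simps)
  ultimately show ?thesis
    using e(1) by simp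
qed simp

lemma metric_projection_self: "x \<in> C \<Longrightarrow> metric_projection C x = {x}"
  by (force simp: metric_projection_def)

section \<open>Testing the Mordukhovich derivative\<close>

text \<open>A numerator that is nonpositive near the point makes the quotient nonpositive there;
  this crude criterion suffices for the memberships in (C) and (E).\<close>

lemma mordukhovich_derivativeI:
  fixes xstar :: "'a::banach \<Rightarrow>\<^sub>L real" and ystar :: "'b::banach \<Rightarrow>\<^sub>L real"
  assumes "\<forall>\<^sub>F (u, v) in at (x, y) within gph F. xstar (u - x) \<le> ystar (v - y)"
  shows "xstar \<in> mordukhovich_derivative F x y ystar"
  unfolding mordukhovich_derivative_def mem_Collect_eq
proof (rule Limsup_bounded)
  show "\<forall>\<^sub>F p in at (x, y) within gph F.
      (case p of (u, v) \<Rightarrow> ereal ((xstar (u - x) - ystar (v - y)) / (norm (u - x) + norm (v - y)))) \<le> 0"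
    using assms
    by eventually_elim (auto intro!: divide_nonpos_nonneg)
qed

text \<open>Along the segment the difference quotient does not depend on \<open>t\<close>, so the
  limsup condition bounds its constant value \<open>q\<close> by 0.\<close>

lemma mordukhovich_derivative_direction:
  assumes xstar: "xstar \<in> mordukhovich_derivative F x y ystar"
    and gph: "\<forall>\<^sub>F t in at_right 0. y + t *\<^sub>R b \<in> F (x + t *\<^sub>R a)"
  shows "xstar a \<le> ystar b"
proof (cases "a = 0 \<and> b = 0")
  case True
  then show ?thesis by (simp add: blinfun.zero_right)
next
  case False
  let ?f = "\<lambda>(u, v). ereal ((xstar (u - x) - ystar (v - y)) / (norm (u - x) + norm (v - y)))"
  let ?g = "\<lambda>t. (x + t *\<^sub>R a, y + t *\<^sub>R b)"
  define q where "q = (xstar a - ystar b) / (norm a + norm b)"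
  have pos: "norm a + norm b > 0"
    using False by (auto simp: add_pos_nonneg add_nonneg_pos)
  have "(?g \<longlongrightarrow> (x + 0 *\<^sub>R a, y + 0 *\<^sub>R b)) (at_right 0)"
    by (intro tendsto_intros)
  then have lim: "filterlim ?g (at (x, y) within gph F) (at_right 0)"
  proof (intro filterlim_at[THEN iffD2] conjI)
    show "\<forall>\<^sub>F t in at_right 0. ?g t \<in> gph F \<and> ?g t \<noteq> (x, y)"
      using gph eventually_at_right_less[of 0]
      by eventually_elim (use False in \<open>auto simp: gph_def\<close>)
  qed simp
  have "q \<le> e" if "e > 0" for e
  proof -
    have "Limsup (at (x, y) within gph F) ?f < ereal e"
      using xstar that by (auto simp: mordukhovich_derivative_def intro: le_less_trans)
    then have "\<forall>\<^sub>F p in at (x, y) within gph F. ?f p < ereal e"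
      by (rule Limsup_lessD)
    then have "\<forall>\<^sub>F t in at_right 0. ?f (?g t) < ereal e"
      using lim by (auto simp: filterlim_iff)
    then have "\<forall>\<^sub>F t :: real in at_right 0. q < e"
      using eventually_at_right_less[of 0]
    proof eventually_elim
      case (elim t)
      have "(xstar (t *\<^sub>R a) - ystar (t *\<^sub>R b)) / (norm (t *\<^sub>R a) + norm (t *\<^sub>R b))
          = (t * (xstar a - ystar b)) / (t * (norm a + norm b))"
        using elim(2) by (simp add: blinfun.scaleR_right algebra_simps)
      also have "\<dots> = q"
        using elim(2) by (simp add: q_def)
      finally show ?case using elim(1) by simp
    qed
    then show ?thesis by simp
  qed
  then have "q \<le> 0"
    by (rule field_le_epsilon[of q 0, simplified])
  then show ?thesis
    using pos by (simp add: q_def divide_le_0_iff)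
qed

section \<open>Norms and coordinate sums in the space of summable sequences\<close>

text \<open>The two norm series differ in the single term of index \<open>n\<close>.\<close>

lemma norm_l1_add_unit:
  "norm (x + h *\<^sub>R l1_unit n) = norm x + \<bar>l1_nth x n + h\<bar> - \<bar>l1_nth x n\<bar>"
proof -
  have "(\<lambda>k. \<bar>l1_nth x k\<bar> + (if k = n then \<bar>l1_nth x n + h\<bar> - \<bar>l1_nth x n\<bar> else 0))
      sums (norm x + (\<bar>l1_nth x n + h\<bar> - \<bar>l1_nth x n\<bar>))"
    unfolding norm_l1_def by (intro sums_add summable_sums summable_abs_l1 sums_single)
  moreover have "\<bar>l1_nth (x + h *\<^sub>R l1_unit n) k\<bar>
      = \<bar>l1_nth x k\<bar> + (if k = n then \<bar>l1_nth x n + h\<bar> - \<bar>l1_nth x n\<bar> else 0)" for k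
    by (simp add: l1_unit.rep_eq)
  ultimately show ?thesis
    by (simp add: norm_l1_def sums_iff)
qed

lemma abs_suminf_le_norm_l1: "\<bar>\<Sum>n. l1_nth x n\<bar> \<le> norm x"
  unfolding norm_l1_def by (rule summable_rabs) simp

text \<open>The terms \<open>?d n\<close> are nonnegative by the triangle inequality and sum to 0,
  so each of them vanishes.\<close>

lemma norm_l1_diff_eqD:
  assumes "norm (x - y) = norm x - norm y"
  shows "\<bar>l1_nth x n - l1_nth y n\<bar> = \<bar>l1_nth x n\<bar> - \<bar>l1_nth y n\<bar>"
proof -
  let ?d = "\<lambda>n. \<bar>l1_nth (x - y) n\<bar> - \<bar>l1_nth x n\<bar> + \<bar>l1_nth y n\<bar>"
  have "?d sums (norm (x - y) - norm x + norm y)"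
    unfolding norm_l1_def by (intro sums_add sums_diff summable_sums summable_abs_l1)
  then have d: "?d sums 0"
    using assms by simp
  have "?d n = 0"
    using suminf_eq_zero_iff[of ?d] d by (auto simp: sums_iff)
  then show ?thesis by simp
qed

lemma norm_l1_eq_suminf:
  assumes "\<And>n. s * l1_nth x n \<ge> 0" "\<bar>s\<bar> = 1"
  shows "norm x = s * (\<Sum>n. l1_nth x n)"
proof -
  have "\<bar>l1_nth x n\<bar> = s * l1_nth x n" for n
    using assms(1)[of n] abs_mult[of s "l1_nth x n"] assms(2) by simp
  then show ?thesis
    by (simp add: norm_l1_def suminf_mult)
qed

lemma linf_dual_const:
  fixes ystar :: linf
  assumes "\<And>n. ystar n = c"
  shows "linf_dual ystar x = c * (\<Sum>n. l1_nth x n)"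
  by (simp add: linf_dual.rep_eq assms suminf_mult2[symmetric])

lemma linf_dual_diff_const:
  fixes ystar :: linf
  assumes "\<And>n. ystar n = c"
  shows "linf_dual ystar (v - y) = c * (\<Sum>n. l1_nth v n) - c * (\<Sum>n. l1_nth y n)"
  by (simp add: linf_dual_const[OF assms] blinfun.diff_right)

lemma linf_dual_0 [simp]: "linf_dual 0 = 0"
  by (rule blinfun_eqI) (simp add: linf_dual.rep_eq)

section \<open>The derivative of the projection in the space of summable sequences\<close>

text \<open>The sign \<open>s\<close> treats (A) and (B) simultaneously.\<close>

lemma mordukhovich_proj_ball_sign:
  assumes x: "norm x \<ge> 1" and y: "y \<in> proj_ball x"
    and xstar: "xstar \<in> mordukhovich_derivative_l1 proj_ball x y ystar"
    and s: "\<bar>s\<bar> = 1" "s * l1_nth x n \<ge> 0"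
  shows "s * xstar n \<le> 0"
proof -
  have "y + t *\<^sub>R 0 \<in> proj_ball (x + t *\<^sub>R s *\<^sub>R l1_unit n)" if "t > 0" for t
  proof -
    \<comment> \<open>The shift points away from 0 in coordinate \<open>n\<close>, so the norm of
      \<open>x\<close> grows by exactly \<open>t\<close>.\<close>
    have "s = 1 \<or> s = -1"
      using s(1) by linarith
    then have norm_eq: "norm (x + t *\<^sub>R s *\<^sub>R l1_unit n) = norm x + t"
      using s(2) that by (auto simp: norm_l1_add_unit[of x "t * s" n, simplified])
    have "norm (x + t *\<^sub>R s *\<^sub>R l1_unit n - y) \<le> norm (x - y) + norm (t *\<^sub>R s *\<^sub>R l1_unit n)"
      using norm_triangle_ineq[of "x - y" "t *\<^sub>R s *\<^sub>R l1_unit n"] by (simp add: algebra_simps)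
    also have "\<dots> = norm x + t - 1"
      using s(1) y x that by (simp add: mem_metric_projection_cball_iff norm_l1_unit abs_mult)
    finally show ?thesis
      using norm_triangle_ineq2[of "x + t *\<^sub>R s *\<^sub>R l1_unit n" y] norm_eq x y that
        norm_metric_projection_cball[OF x y]
      by (simp add: mem_metric_projection_cball_iff)
  qed
  then have "\<forall>\<^sub>F t in at_right 0. y + t *\<^sub>R 0 \<in> proj_ball (x + t *\<^sub>R s *\<^sub>R l1_unit n)"
    using eventually_at_right_less[of 0] by (rule eventually_mono[rotated])
  then have "linf_dual xstar (s *\<^sub>R l1_unit n) \<le> linf_dual ystar 0"
    using xstar unfolding mordukhovich_derivative_l1_def
    by (intro mordukhovich_derivative_direction[of _ proj_ball x y]) simp_all
  then show ?thesis
    by (simp add: blinfun.scaleR_right blinfun.zero_right linf_dual_unit)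
qed

text \<open>The signed sum of \<open>x - y\<close> is \<open>norm x\<close> minus that of
  \<open>y\<close>, but at most \<open>norm (x - y) = norm x - 1\<close>; hence the signed sum of
  \<open>y\<close> is at least 1.\<close>

lemma suminf_proj_ball:
  assumes x: "norm x \<ge> 1" and y: "y \<in> proj_ball x"
    and s: "\<bar>s\<bar> = 1" "\<And>n. s * l1_nth x n \<ge> 0"
  shows "s * (\<Sum>n. l1_nth y n) = 1"
proof (rule antisym)
  have s_le: "s * (\<Sum>n. l1_nth z n) \<le> norm z" for z
    using abs_suminf_le_norm_l1[of z] s(1) abs_le_D1[of "s * (\<Sum>n. l1_nth z n)"]
    by (simp add: abs_mult)
  show "s * (\<Sum>n. l1_nth y n) \<le> 1"
    using s_le[of y] norm_metric_projection_cball[OF x y] by simp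
  have "s * (\<Sum>n. l1_nth (x - y) n) = norm x - s * (\<Sum>n. l1_nth y n)"
    by (simp add: norm_l1_eq_suminf[OF s(2,1)] suminf_diff[symmetric] right_diff_distrib)
  then show "1 \<le> s * (\<Sum>n. l1_nth y n)"
    using s_le[of "x - y"] x y by (simp add: mem_metric_projection_cball_iff)
qed

text \<open>The hypothesis on \<open>y\<close> says that it attains the lower bound
  \<open>- \<bar>c\<bar>\<close> of \<open>linf_dual ystar\<close> on the ball. It covers both
  \<open>c \<le> 0\<close> with sum 1 and \<open>c \<ge> 0\<close> with sum -1.\<close>

lemma zero_mem_mordukhovich_proj_ball:
  fixes ystar :: linf
  assumes ystar: "\<And>n. ystar n = c" and y: "c * (\<Sum>n. l1_nth y n) = - \<bar>c\<bar>"
  shows "0 \<in> mordukhovich_derivative_l1 proj_ball x y ystar"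
  unfolding mordukhovich_derivative_l1_def mem_Collect_eq
proof (rule mordukhovich_derivativeI)
  have "linf_dual 0 (u - x) \<le> linf_dual ystar (v - y)" if "v \<in> proj_ball u" for u v
  proof -
    have "\<bar>\<Sum>n. l1_nth v n\<bar> \<le> 1"
      using abs_suminf_le_norm_l1[of v] that by (simp add: metric_projection_def)
    then have "\<bar>c * (\<Sum>n. l1_nth v n)\<bar> \<le> \<bar>c\<bar>"
      by (simp add: abs_mult mult_left_le)
    then show ?thesis
      using y by (simp add: linf_dual_diff_const[OF ystar])
  qed
  then show "\<forall>\<^sub>F (u, v) in at (x, y) within gph proj_ball.
      linf_dual 0 (u - x) \<le> linf_dual ystar (v - y)"
    unfolding eventually_at_filter by (intro always_eventually) (auto simp: gph_def)
qed

lemma zero_notin_mordukhovich_proj_ball: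
  fixes ystar :: linf
  assumes x: "norm x \<ge> 1" and y: "y \<in> proj_ball x"
    and ystar: "\<And>n. ystar n = c" "c \<noteq> 0"
    and sum_y: "\<bar>\<Sum>n. l1_nth y n\<bar> < 1"
  shows "0 \<notin> mordukhovich_derivative_l1 proj_ball x y ystar"
proof
  assume zero: "0 \<in> mordukhovich_derivative_l1 proj_ball x y ystar"
  note norm_y = norm_metric_projection_cball[OF x y]
  \<comment> \<open>If all entries of \<open>y\<close> had one weak sign, the modulus of their sum
    would be the norm 1; so both strict signs occur.\<close>
  have "\<exists>i. s * l1_nth y i < 0" if "\<bar>s\<bar> = 1" for s
  proof (rule ccontr)
    assume "\<nexists>i. s * l1_nth y i < 0"
    then have "norm y = s * (\<Sum>n. l1_nth y n)"
      using that by (intro norm_l1_eq_suminf) (auto simp: not_less)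
    then show False
      using norm_y sum_y that abs_mult[of s "\<Sum>n. l1_nth y n"] by simp
  qed
  from this[of "-1"] this[of 1] obtain i j where i: "l1_nth y i > 0" and j: "l1_nth y j < 0"
    by auto
  have coord: "\<bar>l1_nth x n - l1_nth y n\<bar> = \<bar>l1_nth x n\<bar> - \<bar>l1_nth y n\<bar>" for n
    using x y norm_y by (intro norm_l1_diff_eqD) (simp add: mem_metric_projection_cball_iff)
  have xi: "l1_nth x i \<ge> l1_nth y i" and xj: "l1_nth x j \<le> l1_nth y j"
    using coord[of i] coord[of j] i j by linarith+
  have ij: "i \<noteq> j"
    using i j by auto
  \<comment> \<open>The sign is opposite to \<open>c\<close>, so that \<open>linf_dual ystar\<close>
    is negative on \<open>a\<close>.\<close>
  define s where "s = - sgn c"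
  define a where "a = s *\<^sub>R (l1_unit i + l1_unit j)"
  \<comment> \<open>Shifts shorter than \<open>\<delta>\<close> keep the signs of coordinates
    \<open>i\<close> and \<open>j\<close> in \<open>y\<close>, and also in \<open>x\<close>, whose
    entries there are at least as far from 0. One modulus gains what the other loses.\<close>
  define \<delta> where "\<delta> = min (l1_nth y i) (- l1_nth y j)"
  have "\<delta> > 0"
    using i j by (simp add: \<delta>_def)
  have norm_eq: "norm (z + t *\<^sub>R a) = norm z"
    if "0 < t" "t < \<delta>" "l1_nth z i \<ge> l1_nth y i" "l1_nth z j \<le> l1_nth y j" for z t
  proof -
    have "\<bar>t * s\<bar> < \<delta>"
      using that ystar(2) by (simp add: s_def abs_mult abs_sgn_eq)
    then have "\<bar>l1_nth z i + t * s\<bar> - \<bar>l1_nth z i\<bar> = t * s"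
      "\<bar>l1_nth z j + t * s\<bar> - \<bar>l1_nth z j\<bar> = - (t * s)"
      using that i j by (auto simp: \<delta>_def)
    moreover have "z + t *\<^sub>R a = z + (t * s) *\<^sub>R l1_unit i + (t * s) *\<^sub>R l1_unit j"
      by (simp add: a_def scaleR_add_right)
    then have "norm (z + t *\<^sub>R a) = norm z + \<bar>l1_nth z i + t * s\<bar> - \<bar>l1_nth z i\<bar>
        + \<bar>l1_nth z j + t * s\<bar> - \<bar>l1_nth z j\<bar>"
      using ij by (simp only: norm_l1_add_unit) (simp add: l1_unit.rep_eq)
    ultimately show ?thesis
      by linarith
  qed
  \<comment> \<open>The common shift leaves \<open>x - y\<close> unchanged, and both norms are
    preserved.\<close>
  have "y + t *\<^sub>R a \<in> proj_ball (x + t *\<^sub>R a)" if "0 < t" "t < \<delta>" for t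
    using x y norm_eq[OF that, of x] norm_eq[OF that, of y] xi xj
    by (simp add: mem_metric_projection_cball_iff)
  then have "\<forall>\<^sub>F t in at_right 0. y + t *\<^sub>R a \<in> proj_ball (x + t *\<^sub>R a)"
    using eventually_at_right_less[of 0] eventually_at_right_real[OF \<open>\<delta> > 0\<close>]
    by (auto elim!: eventually_mono)
  then have "linf_dual 0 a \<le> linf_dual ystar a"
    using zero unfolding mordukhovich_derivative_l1_def
    by (intro mordukhovich_derivative_direction[of _ proj_ball x y]) simp_all
  also have "linf_dual ystar a = - 2 * \<bar>c\<bar>"
    by (simp add: a_def s_def blinfun.scaleR_right blinfun.add_right blinfun.minus_right
        linf_dual_unit ystar abs_sgn)
  finally show False
    using ystar(2) by simp
qed

lemma mordukhovich_proj_ball_interior: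
  assumes "norm x < 1"
  shows "mordukhovich_derivative_l1 proj_ball x x ystar = {ystar}"
proof (rule set_eqI)
  fix xstar :: linf
  have near: "\<forall>\<^sub>F u in nhds x. proj_ball u = {u}"
  proof -
    have "\<forall>\<^sub>F u in nhds x. u \<in> ball 0 1"
      using assms by (intro eventually_nhds_in_open) auto
    then show ?thesis
      by eventually_elim (rule metric_projection_self, simp)
  qed
  have "xstar = ystar" if xstar: "xstar \<in> mordukhovich_derivative_l1 proj_ball x x ystar"
  proof -
    have le: "linf_dual xstar a \<le> linf_dual ystar a" for a
    proof (rule mordukhovich_derivative_direction)
      show "linf_dual xstar \<in> mordukhovich_derivative proj_ball x x (linf_dual ystar)"
        using xstar by (simp add: mordukhovich_derivative_l1_def)
      have "((\<lambda>t. x + t *\<^sub>R a) \<longlongrightarrow> x + 0 *\<^sub>R a) (at_right 0)"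
        by (intro tendsto_intros)
      then have "\<forall>\<^sub>F t in at_right 0. proj_ball (x + t *\<^sub>R a) = {x + t *\<^sub>R a}"
        using near by (auto simp: filterlim_iff)
      then show "\<forall>\<^sub>F t in at_right 0. x + t *\<^sub>R a \<in> proj_ball (x + t *\<^sub>R a)"
        by eventually_elim simp
    qed
    \<comment> \<open>Every direction is admissible, so \<open>a\<close> and \<open>- a\<close> give
      the two inequalities.\<close>
    have "linf_dual xstar a = linf_dual ystar a" for a
      using le[of a] le[of "- a"] by (simp add: blinfun.minus_right)
    then show ?thesis
      using bij_linf_dual by (meson bij_is_inj blinfun_eqI injD)
  qed
  moreover have "ystar \<in> mordukhovich_derivative_l1 proj_ball x x ystar"
    unfolding mordukhovich_derivative_l1_def mem_Collect_eq
  proof (rule mordukhovich_derivativeI)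
    have "\<forall>\<^sub>F p in nhds (x, x). proj_ball (fst p) = {fst p}"
      using near filterlim_fst by (auto simp: nhds_prod filterlim_iff)
    \<comment> \<open>Near \<open>(x, x)\<close> the graph is the diagonal, so \<open>u = v\<close>
      and equality holds.\<close>
    then show "\<forall>\<^sub>F (u, v) in at (x, x) within gph proj_ball.
        linf_dual ystar (u - x) \<le> linf_dual ystar (v - x)"
      unfolding eventually_at_filter by eventually_elim (auto simp: gph_def)
  qed
  ultimately show "xstar \<in> mordukhovich_derivative_l1 proj_ball x x ystar \<longleftrightarrow> xstar \<in> {ystar}"
    by auto
qed

theorem theorem3p2:
  shows
    "(\<forall>xbar ybar ystar. norm xbar \<ge> 1 \<and> ybar \<in> proj_ball xbar \<longrightarrow>
        \<comment> \<open>(A)\<close>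
        (xbar \<in> nonneg_cone_l1 \<longrightarrow> (\<forall>xstar \<in> mordukhovich_derivative_l1 proj_ball xbar ybar ystar. \<forall>n. xstar n \<le> 0)) \<and>
        \<comment> \<open>(B)\<close>
        (xbar \<in> uminus ` nonneg_cone_l1 \<longrightarrow> (\<forall>xstar \<in> mordukhovich_derivative_l1 proj_ball xbar ybar ystar. \<forall>n. xstar n \<ge> 0)) \<and>
        \<comment> \<open>(C)\<close>
        ((\<forall>n. ystar n = ystar 0) \<longrightarrow>
          ((\<Sum>n. l1_nth ybar n) = 1 \<and> ystar 0 \<le> 0 \<longrightarrow> 0 \<in> mordukhovich_derivative_l1 proj_ball xbar ybar ystar) \<and>
          ((\<Sum>n. l1_nth ybar n) = -1 \<and> ystar 0 \<ge> 0 \<longrightarrow> 0 \<in> mordukhovich_derivative_l1 proj_ball xbar ybar ystar) \<and>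
          (xbar \<in> nonneg_cone_l1 \<and> ystar 0 \<le> 0 \<longrightarrow> 0 \<in> mordukhovich_derivative_l1 proj_ball xbar ybar ystar) \<and>
          (xbar \<in> uminus ` nonneg_cone_l1 \<and> ystar 0 \<ge> 0 \<longrightarrow> 0 \<in> mordukhovich_derivative_l1 proj_ball xbar ybar ystar) \<and>
          (xbar \<in> nonneg_cone_l1 \<longrightarrow> 0 \<in> mordukhovich_derivative_l1 proj_ball xbar ybar (- beta_linf)) \<and>
          (xbar \<in> uminus ` nonneg_cone_l1 \<longrightarrow> 0 \<in> mordukhovich_derivative_l1 proj_ball xbar ybar beta_linf)) \<and>
        \<comment> \<open>(D)\<close>
        ((\<forall>n. ystar n = ystar 0) \<and> ystar 0 \<noteq> 0 \<and>
          -1 < (\<Sum>n. l1_nth ybar n) \<and> (\<Sum>n. l1_nth ybar n) < 1 \<longrightarrow>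
          0 \<notin> mordukhovich_derivative_l1 proj_ball xbar ybar ystar)) \<and>
     \<comment> \<open>(E)\<close>
     (\<forall>xbar \<in> interior unit_ball_l1. proj_ball xbar = {xbar} \<and> (\<forall>ystar. mordukhovich_derivative_l1 proj_ball xbar xbar ystar = {ystar}))"
proof (intro conjI allI impI ballI, goal_cases)
  case (1 x y ystar xstar n)
  then show ?case
    using mordukhovich_proj_ball_sign[of x y xstar ystar 1 n] by (simp add: nonneg_cone_l1_def)
next
  case (2 x y ystar xstar n)
  then show ?case
    using mordukhovich_proj_ball_sign[of x y xstar ystar "-1" n] by (auto simp: nonneg_cone_l1_def)
next
  case (3 x y ystar)
  then show ?case
    by (intro zero_mem_mordukhovich_proj_ball[of _ "ystar 0"]) auto
next
  case (4 x y ystar)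
  then show ?case
    by (intro zero_mem_mordukhovich_proj_ball[of _ "ystar 0"]) auto
next
  case (5 x y ystar)
  \<comment> \<open>Membership of \<open>x\<close> in the cone fixes the coordinate sum of
    \<open>y\<close>, which reduces (III) to the situation of (I); the sign -1 does the same for
    (IV) and (II).\<close>
  then have "(\<Sum>n. l1_nth y n) = 1"
    using suminf_proj_ball[of x y 1] by (simp add: nonneg_cone_l1_def)
  with 5 show ?case
    by (intro zero_mem_mordukhovich_proj_ball[of _ "ystar 0"]) auto
next
  case (6 x y ystar)
  then have "(\<Sum>n. l1_nth y n) = -1"
    using suminf_proj_ball[of x y "-1"] by (auto simp: nonneg_cone_l1_def)
  with 6 show ?case
    by (intro zero_mem_mordukhovich_proj_ball[of _ "ystar 0"]) auto
next
  case (7 x y ystar)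
  then have "(\<Sum>n. l1_nth y n) = 1"
    using suminf_proj_ball[of x y 1] by (simp add: nonneg_cone_l1_def)
  then show ?case
    by (intro zero_mem_mordukhovich_proj_ball[of _ "-1"]) (auto simp: beta_linf_def)
next
  case (8 x y ystar)
  then have "(\<Sum>n. l1_nth y n) = -1"
    using suminf_proj_ball[of x y "-1"] by (auto simp: nonneg_cone_l1_def)
  then show ?case
    by (intro zero_mem_mordukhovich_proj_ball[of _ 1]) (auto simp: beta_linf_def)
next
  case (9 x y ystar)
  then show ?case
    by (intro zero_notin_mordukhovich_proj_ball[of x y ystar "ystar 0"]) auto
next
  case (10 x)
  then show ?case
    using interior_subset by (intro metric_projection_self) blast
next
  case (11 x ystar)
  then show ?case
    by (intro mordukhovich_proj_ball_interior norm_less_one_if_interior_cball)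
qed

end
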